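(* Let $H$ be a Hilbert space of dimension $n<\infty$, let $H_1,\dots,H_m$ be Hilbert spaces with $\dim H_j=l_j<\infty$, and put $l=\sum_{j=1}^m l_j$. Let $\{V_j\}_{j=1}^m$, $V_j\in B(H,H_j)$, be a Parseval (OPV)-frame for $H$. If $l<2n$, then the only tight dual (OPV)-frame for $\{V_j\}_{j=1}^m$ is $\{V_j\}_{j=1}^m$ itself.
   Context: Hilbert spaces are over $\mathbb{R}$ or $\mathbb{C}$. A family $V_j\in B(H,H_j)$, $j=1,\dots,m$, is an operator-valued frame ((OPV)-frame) for $H$ if there are constants $A,B>0$ with $AI\le\sum_{j=1}^m V_j^*V_j\le BI$; it is tight with frame bound $A>0$ if $\sum_{j=1}^m V_j^*V_j=AI$, and Parseval if it is tight with $A=1$. An (OPV)-frame $\{W_j\}_{j=1}^m$, $W_j\in B(H,H_j)$, is dual to $\{V_j\}_{j=1}^m$ if $\sum_{j=1}^m W_j^*V_j=I$. *)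

theory Defs
  imports Complex_Main "Jordan_Normal_Form.Missing_VectorSpace"
begin

text \<open>
  Vector spaces are the carrier-based ones of the locale \<^locale>\<open>vectorspace\<close>, so that the spaces
  of a family \<open>G 1, \<dots>, G m\<close> may have different dimensions and unrelated operations.  Both ground
  fields are subfields of the complex numbers.  This way a real and a complex Hilbert space have
  inner products of the same type, and complex conjugation is the identity in the real case.
\<close>

definition scalar_ring :: "complex set \<Rightarrow> complex ring" where
  "scalar_ring S = \<lparr>carrier = S, mult = (*), one = 1, zero = 0, add = (+)\<rparr>"

definition real_or_complex_field :: "complex ring \<Rightarrow> bool" where
  "real_or_complex_field K \<longleftrightarrow> K = scalar_ring \<real> \<or> K = scalar_ring UNIV"

text \<open>
  The fields \<open>mult\<close> and \<open>one\<close> that \<^type>\<open>module_scheme\<close> inherits from rings are not used.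
\<close>

record 'b ip_module = "(complex, 'b) module" +
  ip :: "'b \<Rightarrow> 'b \<Rightarrow> complex"

definition hnorm :: "'b ip_module \<Rightarrow> 'b \<Rightarrow> real" where
  "hnorm H x = sqrt (Re (ip H x x))"

text \<open>
  The inner product is linear in its first argument.  By \<open>ip_commute\<close>, \<^term>\<open>ip H x x\<close> is real.
\<close>

locale hilbert_space = vectorspace K H
  for K :: "complex ring" and H :: "'b ip_module" (structure) +
  assumes scalars: "real_or_complex_field K"
    and ip_closed: "\<lbrakk>x \<in> carrier H; y \<in> carrier H\<rbrakk> \<Longrightarrow> ip H x y \<in> carrier K"
    and ip_add_left: "\<lbrakk>x \<in> carrier H; y \<in> carrier H; z \<in> carrier H\<rbrakk>
      \<Longrightarrow> ip H (x \<oplus>\<^bsub>H\<^esub> y) z = ip H x z + ip H y z"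
    and ip_smult_left: "\<lbrakk>c \<in> carrier K; x \<in> carrier H; y \<in> carrier H\<rbrakk>
      \<Longrightarrow> ip H (c \<odot>\<^bsub>H\<^esub> x) y = c * ip H x y"
    and ip_commute: "\<lbrakk>x \<in> carrier H; y \<in> carrier H\<rbrakk> \<Longrightarrow> ip H x y = cnj (ip H y x)"
    and ip_nonneg: "x \<in> carrier H \<Longrightarrow> 0 \<le> Re (ip H x x)"
    and ip_definite: "\<lbrakk>x \<in> carrier H; ip H x x = 0\<rbrakk> \<Longrightarrow> x = \<zero>\<^bsub>H\<^esub>"
    and complete: "\<lbrakk>\<And>k. X k \<in> carrier H;
        \<And>e. e > 0 \<Longrightarrow> \<exists>N. \<forall>i\<ge>N. \<forall>j\<ge>N. hnorm H (X i \<ominus>\<^bsub>H\<^esub> X j) < e\<rbrakk>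
      \<Longrightarrow> \<exists>x\<in>carrier H. (\<lambda>k. hnorm H (X k \<ominus>\<^bsub>H\<^esub> x)) \<longlonglongrightarrow> 0"

definition bounded_ops :: "complex ring \<Rightarrow> 'b ip_module \<Rightarrow> 'c ip_module \<Rightarrow> ('b \<Rightarrow> 'c) set" where
  "bounded_ops K H G = {T \<in> module_hom K H G.
     \<exists>C. \<forall>x\<in>carrier H. hnorm G (T x) \<le> C * hnorm H x}"

text \<open>
  For Hilbert spaces \<open>H\<close>, \<open>G\<close> and \<^term>\<open>T \<in> bounded_ops K H G\<close> the element described here exists
  and is unique for all \<^term>\<open>y \<in> carrier G\<close>, by the Riesz representation theorem.
\<close>

definition adj :: "'b ip_module \<Rightarrow> 'c ip_module \<Rightarrow> ('b \<Rightarrow> 'c) \<Rightarrow> 'c \<Rightarrow> 'b" where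
  "adj H G T y = (THE z. z \<in> carrier H \<and> (\<forall>x\<in>carrier H. ip G (T x) y = ip H x z))"

definition positive_op :: "'b ip_module \<Rightarrow> ('b \<Rightarrow> 'b) \<Rightarrow> bool" where
  "positive_op H P \<longleftrightarrow>
     (\<forall>x\<in>carrier H. \<forall>y\<in>carrier H. ip H (P x) y = ip H x (P y)) \<and>
     (\<forall>x\<in>carrier H. 0 \<le> Re (ip H (P x) x))"

definition op_le :: "'b ip_module \<Rightarrow> ('b \<Rightarrow> 'b) \<Rightarrow> ('b \<Rightarrow> 'b) \<Rightarrow> bool" where
  "op_le H S T \<longleftrightarrow> positive_op H (\<lambda>x. T x \<ominus>\<^bsub>H\<^esub> S x)"

definition scalar_op :: "'b ip_module \<Rightarrow> real \<Rightarrow> 'b \<Rightarrow> 'b" where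
  "scalar_op H A x = complex_of_real A \<odot>\<^bsub>H\<^esub> x"

text \<open>The operator \<open>\<Sum>\<^sub>j W\<^sub>j\<^sup>* V\<^sub>j\<close>.\<close>

definition mixed_op :: "nat \<Rightarrow> 'b ip_module \<Rightarrow> (nat \<Rightarrow> 'c ip_module) \<Rightarrow>
    (nat \<Rightarrow> 'b \<Rightarrow> 'c) \<Rightarrow> (nat \<Rightarrow> 'b \<Rightarrow> 'c) \<Rightarrow> 'b \<Rightarrow> 'b" where
  "mixed_op m H G W V x = (\<Oplus>\<^bsub>H\<^esub>j\<in>{1..m}. adj H (G j) (W j) (V j x))"

definition opv_frame :: "complex ring \<Rightarrow> nat \<Rightarrow> 'b ip_module \<Rightarrow> (nat \<Rightarrow> 'c ip_module) \<Rightarrow>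
    (nat \<Rightarrow> 'b \<Rightarrow> 'c) \<Rightarrow> bool" where
  "opv_frame K m H G V \<longleftrightarrow>
     (\<forall>j\<in>{1..m}. V j \<in> bounded_ops K H (G j)) \<and>
     (\<exists>A>0. \<exists>B>0. op_le H (scalar_op H A) (mixed_op m H G V V) \<and>
                  op_le H (mixed_op m H G V V) (scalar_op H B))"

definition tight_opv_frame_with_bound :: "complex ring \<Rightarrow> nat \<Rightarrow> 'b ip_module \<Rightarrow>
    (nat \<Rightarrow> 'c ip_module) \<Rightarrow> (nat \<Rightarrow> 'b \<Rightarrow> 'c) \<Rightarrow> real \<Rightarrow> bool" where
  "tight_opv_frame_with_bound K m H G V A \<longleftrightarrow>
     opv_frame K m H G V \<and> A > 0 \<and>
     (\<forall>x\<in>carrier H. mixed_op m H G V V x = scalar_op H A x)"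

definition tight_opv_frame :: "complex ring \<Rightarrow> nat \<Rightarrow> 'b ip_module \<Rightarrow>
    (nat \<Rightarrow> 'c ip_module) \<Rightarrow> (nat \<Rightarrow> 'b \<Rightarrow> 'c) \<Rightarrow> bool" where
  "tight_opv_frame K m H G V \<longleftrightarrow> (\<exists>A. tight_opv_frame_with_bound K m H G V A)"

definition parseval_opv_frame :: "complex ring \<Rightarrow> nat \<Rightarrow> 'b ip_module \<Rightarrow>
    (nat \<Rightarrow> 'c ip_module) \<Rightarrow> (nat \<Rightarrow> 'b \<Rightarrow> 'c) \<Rightarrow> bool" where
  "parseval_opv_frame K m H G V \<longleftrightarrow> tight_opv_frame_with_bound K m H G V 1"

definition dual_opv_frame :: "complex ring \<Rightarrow> nat \<Rightarrow> 'b ip_module \<Rightarrow>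
    (nat \<Rightarrow> 'c ip_module) \<Rightarrow> (nat \<Rightarrow> 'b \<Rightarrow> 'c) \<Rightarrow> (nat \<Rightarrow> 'b \<Rightarrow> 'c) \<Rightarrow> bool" where
  "dual_opv_frame K m H G V W \<longleftrightarrow>
     opv_frame K m H G W \<and> (\<forall>x\<in>carrier H. mixed_op m H G W V x = x)"

end

theory Submission
  imports Defs
begin

text \<open>
  Put \<open>U\<^sub>j = W\<^sub>j - V\<^sub>j\<close>.  Duality and tightness with bound \<open>A\<close> give \<open>\<Sum>\<^sub>j U\<^sub>j\<^sup>* V\<^sub>j = 0\<close> and
  \<open>\<Sum>\<^sub>j U\<^sub>j\<^sup>* U\<^sub>j = (A - 1) I\<close>.  If \<open>A \<noteq> 1\<close>, then \<open>A > 1\<close>, and the images of an orthonormal basis of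
  \<open>H\<close> under \<open>V\<close> and under \<open>U / sqrt (A - 1)\<close> are together \<open>2 n\<close> orthonormal vectors in the direct sum
  of the \<open>H\<^sub>j\<close>, which contradicts \<open>l < 2 n\<close>.  Hence \<open>A = 1\<close> and \<open>U = 0\<close>.  The direct sum is
  represented by coordinates with respect to orthonormal bases of the \<open>H\<^sub>j\<close>.
\<close>

section \<open>Inner product calculus over the two scalar fields\<close>

context hilbert_space
begin

lemma scalar_simps [simp]:
  "c \<oplus>\<^bsub>K\<^esub> d = c + d" "c \<otimes>\<^bsub>K\<^esub> d = c * d" "\<zero>\<^bsub>K\<^esub> = 0" "\<one>\<^bsub>K\<^esub> = 1"
  using scalars by (auto simp: real_or_complex_field_def scalar_ring_def)

lemma scalars_closed [simp, intro]:
  "complex_of_real r \<in> carrier K" "c \<in> carrier K \<Longrightarrow> cnj c \<in> carrier K"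
  using scalars by (auto simp: real_or_complex_field_def scalar_ring_def Reals_cnj_iff)

lemma ip_smult_right:
  assumes "c \<in> carrier K" "x \<in> carrier H" "y \<in> carrier H"
  shows "ip H y (c \<odot>\<^bsub>H\<^esub> x) = cnj c * ip H y x"
  using assms by (metis complex_cnj_mult ip_commute ip_smult_left smult_closed)

lemma ip_zero_left [simp]: "y \<in> carrier H \<Longrightarrow> ip H \<zero>\<^bsub>H\<^esub> y = 0"
  using ip_add_left[of "\<zero>\<^bsub>H\<^esub>" "\<zero>\<^bsub>H\<^esub>" y] by simp

lemma ip_minus_left:
  assumes "x \<in> carrier H" "y \<in> carrier H" "z \<in> carrier H"
  shows "ip H (x \<ominus>\<^bsub>H\<^esub> y) z = ip H x z - ip H y z"
proof -
  have "ip H (\<ominus>\<^bsub>H\<^esub> y) z + ip H y z = 0"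
    using assms by (simp add: ip_add_left[symmetric] M.l_neg)
  then show ?thesis
    using assms by (simp add: a_minus_def ip_add_left eq_neg_iff_add_eq_0)
qed

lemma ip_finsum_left:
  assumes "finite A" "f \<in> A \<rightarrow> carrier H" "y \<in> carrier H"
  shows "ip H (\<Oplus>\<^bsub>H\<^esub>a\<in>A. f a) y = (\<Sum>a\<in>A. ip H (f a) y)"
  using assms by (induction A) (auto simp: M.finsum_insert ip_add_left Pi_iff)

lemma ip_self_real: "x \<in> carrier H \<Longrightarrow> ip H x x = complex_of_real (Re (ip H x x))"
  by (metis Reals_cnj_iff complex_is_Real_iff ip_commute of_real_Re)

lemma minus_eq_zero_iff:
  assumes "x \<in> carrier H" "y \<in> carrier H"
  shows "x \<ominus>\<^bsub>H\<^esub> y = \<zero>\<^bsub>H\<^esub> \<longleftrightarrow> x = y"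
  using assms M.minus_equality[of x "\<ominus>\<^bsub>H\<^esub> y"] by (auto simp: a_minus_def M.r_neg)

text \<open>The difference of the two vectors is orthogonal to itself. This is the uniqueness half
  of the Riesz representation theorem and makes the description in \<open>adj\<close>
  unambiguous.\<close>

lemma ip_right_cong:
  assumes "x \<in> carrier H" "y \<in> carrier H" "\<And>z. z \<in> carrier H \<Longrightarrow> ip H z x = ip H z y"
  shows "x = y"
proof -
  have "ip H (x \<ominus>\<^bsub>H\<^esub> y) (x \<ominus>\<^bsub>H\<^esub> y) = 0"
    using assms by (metis M.minus_closed cancel_comm_monoid_add_class.diff_cancel
        ip_commute ip_minus_left)
  then show ?thesis
    using assms by (metis M.minus_closed minus_eq_zero_iff ip_definite)
qed

section \<open>Orthonormal systems and orthonormal bases\<close>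

definition orthonormal :: "'b set \<Rightarrow> bool" where
  "orthonormal E \<longleftrightarrow> E \<subseteq> carrier H \<and> (\<forall>e\<in>E. \<forall>f\<in>E. ip H e f = (if e = f then 1 else 0))"

text \<open>The Fourier expansion stands in for the spanning condition, since it is the form needed
  for Parseval's identity and for the explicit adjoint.\<close>

definition orthonormal_basis :: "'b set \<Rightarrow> bool" where
  "orthonormal_basis E \<longleftrightarrow> finite E \<and> orthonormal E \<and>
     (\<forall>x\<in>carrier H. (\<Oplus>\<^bsub>H\<^esub>e\<in>E. ip H x e \<odot>\<^bsub>H\<^esub> e) = x)"

lemma ip_lincomb_orthonormal:
  assumes "finite E" "orthonormal E" "a \<in> E \<rightarrow> carrier K" "e \<in> E"
  shows "ip H (\<Oplus>\<^bsub>H\<^esub>f\<in>E. a f \<odot>\<^bsub>H\<^esub> f) e = a e"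
proof -
  have c: "f \<in> carrier H" "a f \<in> carrier K" if "f \<in> E" for f
    using assms that by (auto simp: orthonormal_def)
  have "ip H (\<Oplus>\<^bsub>H\<^esub>f\<in>E. a f \<odot>\<^bsub>H\<^esub> f) e = (\<Sum>f\<in>E. a f * ip H f e)"
    using assms c by (subst ip_finsum_left) (auto simp: ip_smult_left)
  also have "\<dots> = (\<Sum>f\<in>E. if f = e then a e else 0)"
    using assms by (intro sum.cong) (auto simp: orthonormal_def)
  finally show ?thesis using assms by simp
qed

text \<open>Pairing a vanishing combination with one of its vectors returns the coefficient of that
  vector.\<close>

lemma orthonormal_lin_indpt:
  assumes "orthonormal E"
  shows "lin_indpt E"
proof
  assume "lin_dep E"
  then obtain A a v where A: "finite A" "A \<subseteq> E" "a \<in> A \<rightarrow> carrier K"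
    "lincomb a A = \<zero>\<^bsub>H\<^esub>" "v \<in> A" "a v \<noteq> 0"
    unfolding lin_dep_def by auto
  have "orthonormal A" using assms A(2) unfolding orthonormal_def by blast
  with A have "ip H (lincomb a A) v = a v"
    unfolding lincomb_def by (intro ip_lincomb_orthonormal)
  moreover have "v \<in> carrier H" using assms A by (auto simp: orthonormal_def)
  ultimately show False using A by simp
qed

text \<open>The normalization step of Gram-Schmidt. The new vector cannot lie in \<open>E\<close>:
  it would be orthogonal to itself although it has norm 1.\<close>

lemma orthonormal_insert_normalized:
  assumes E: "orthonormal E" and z: "z \<in> carrier H" "z \<noteq> \<zero>\<^bsub>H\<^esub>" "\<And>e. e \<in> E \<Longrightarrow> ip H z e = 0"
  obtains u where "u \<notin> E" "orthonormal (insert u E)"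
proof -
  define r where "r = Re (ip H z z)"
  have zz: "ip H z z = complex_of_real r" using z by (simp add: r_def ip_self_real[symmetric])
  have "r \<noteq> 0" using ip_definite[OF z(1)] z(2) zz by auto
  moreover have "r \<ge> 0" unfolding r_def by (rule ip_nonneg[OF z(1)])
  ultimately have r: "r > 0" by simp
  \<comment> \<open>The factor is real, so it belongs to the scalar field in both cases.\<close>
  define u where "u = complex_of_real (1 / sqrt r) \<odot>\<^bsub>H\<^esub> z"
  have u: "u \<in> carrier H" using z by (simp add: u_def del: of_real_divide)
  have uu: "ip H u u = 1"
  proof -
    have "ip H u u = of_real (1 / sqrt r) * (of_real (1 / sqrt r) * of_real r)"
      unfolding u_def using z zz
      by (simp add: ip_smult_left ip_smult_right del: of_real_divide)
    also have "\<dots> = complex_of_real (1 / sqrt r * (1 / sqrt r * r))"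
      by (simp only: of_real_mult)
    also have "1 / sqrt r * (1 / sqrt r * r) = 1"
      using r by (simp add: field_simps)
    finally show ?thesis by simp
  qed
  have ue: "ip H u e = 0" "ip H e u = 0" if "e \<in> E" for e
  proof -
    have e: "e \<in> carrier H" using E that by (auto simp: orthonormal_def)
    show "ip H u e = 0" using z e that by (simp add: u_def ip_smult_left del: of_real_divide)
    then show "ip H e u = 0" using e u by (subst ip_commute) auto
  qed
  have "u \<notin> E" using uu ue by force
  moreover have "orthonormal (insert u E)"
    using E u uu ue \<open>u \<notin> E\<close> by (auto simp: orthonormal_def)
  ultimately show ?thesis using that by blast
qed

text \<open>An orthonormal set of maximal cardinality works: if a vector differed from its Fourier
  expansion, the residual would be orthogonal to the set and, once normalized, could be added to it.
  Independence and spanning together then fix the cardinality.\<close>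

lemma orthonormal_basis_exists:
  assumes "fin_dim"
  obtains E where "orthonormal_basis E" "card E = dim"
proof -
  have bound: "finite E \<and> card E \<le> dim" if "orthonormal E" for E
    using that assms orthonormal_lin_indpt li_le_dim by (auto simp: orthonormal_def)
  have "orthonormal {}" by (simp add: orthonormal_def)
  \<comment> \<open>Independence keeps all cardinalities strictly below \<open>Suc dim\<close>, so a
    largest one is attained.\<close>
  then obtain E where E: "orthonormal E" and max: "\<And>F. orthonormal F \<Longrightarrow> card F \<le> card E"
    using ex_has_greatest_nat[of orthonormal "{}" card "Suc dim"] bound
    by (metis less_Suc_eq_le)
  have fin: "finite E" and cE: "E \<subseteq> carrier H" using bound E by (auto simp: orthonormal_def)
  have expand: "(\<Oplus>\<^bsub>H\<^esub>e\<in>E. ip H x e \<odot>\<^bsub>H\<^esub> e) = x" if x: "x \<in> carrier H" for x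
  proof (rule ccontr)
    define s where "s = (\<Oplus>\<^bsub>H\<^esub>e\<in>E. ip H x e \<odot>\<^bsub>H\<^esub> e)"
    assume "(\<Oplus>\<^bsub>H\<^esub>e\<in>E. ip H x e \<odot>\<^bsub>H\<^esub> e) \<noteq> x"
    then have ne: "s \<noteq> x" by (simp add: s_def)
    have s: "s \<in> carrier H" unfolding s_def using cE x ip_closed by (intro M.finsum_closed) auto
    have "ip H (x \<ominus>\<^bsub>H\<^esub> s) e = 0" if e: "e \<in> E" for e
    proof -
      have "ip H s e = ip H x e"
        unfolding s_def using fin E cE x e ip_closed by (intro ip_lincomb_orthonormal) auto
      then show ?thesis using e cE x s by (subst ip_minus_left) auto
    qed
    moreover have "x \<ominus>\<^bsub>H\<^esub> s \<noteq> \<zero>\<^bsub>H\<^esub>" using x s ne minus_eq_zero_iff by metis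
    ultimately obtain u where "u \<notin> E" "orthonormal (insert u E)"
      using orthonormal_insert_normalized[OF E, of "x \<ominus>\<^bsub>H\<^esub> s"] x s by auto
    with max[of "insert u E"] fin show False by simp
  qed
  have "x \<in> span E" if "x \<in> carrier H" for x
  proof -
    have "lincomb (ip H x) E = x" using expand[OF that] by (simp add: lincomb_def)
    moreover have "ip H x \<in> E \<rightarrow> carrier K" using that cE ip_closed by auto
    ultimately show ?thesis
      unfolding span_def mem_Collect_eq
      by (intro exI[of _ "ip H x"] exI[of _ E] conjI) (use fin in simp_all)
  qed
  then have "gen_set E" using span_is_subset2[OF cE] by blast
  then have "card E = dim" using gen_ge_dim fin cE bound[OF E] by (simp add: le_antisym)
  moreover have "orthonormal_basis E" using fin E expand by (simp add: orthonormal_basis_def)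
  ultimately show ?thesis using that by blast
qed

lemma orthonormal_basis_carrier: "orthonormal_basis E \<Longrightarrow> E \<subseteq> carrier H"
  by (simp add: orthonormal_basis_def orthonormal_def)

text \<open>Parseval's identity. Only the first argument is expanded; conjugate symmetry turns each
  remaining factor \<open>ip H e y\<close> into a coordinate of \<open>y\<close>.\<close>

lemma ip_eq_sum_orthonormal_basis:
  assumes E: "orthonormal_basis E" and x: "x \<in> carrier H" and y: "y \<in> carrier H"
  shows "ip H x y = (\<Sum>e\<in>E. ip H x e * cnj (ip H y e))"
proof -
  have c: "e \<in> carrier H" if "e \<in> E" for e using orthonormal_basis_carrier[OF E] that by auto
  have "ip H x y = ip H (\<Oplus>\<^bsub>H\<^esub>e\<in>E. ip H x e \<odot>\<^bsub>H\<^esub> e) y"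
    using E x by (simp add: orthonormal_basis_def)
  also have "\<dots> = (\<Sum>e\<in>E. ip H (ip H x e \<odot>\<^bsub>H\<^esub> e) y)"
    using E x y c ip_closed by (intro ip_finsum_left) (auto simp: orthonormal_basis_def)
  also have "\<dots> = (\<Sum>e\<in>E. ip H x e * cnj (ip H y e))"
    using x y c ip_closed by (intro sum.cong refl) (metis ip_commute ip_smult_left)
  finally show ?thesis .
qed

lemma orthonormal_basis_eqI:
  assumes "orthonormal_basis E" "x \<in> carrier H" "y \<in> carrier H"
    and "\<And>e. e \<in> E \<Longrightarrow> ip H x e = ip H y e"
  shows "x = y"
proof -
  have "(\<Oplus>\<^bsub>H\<^esub>e\<in>E. ip H x e \<odot>\<^bsub>H\<^esub> e) = (\<Oplus>\<^bsub>H\<^esub>e\<in>E. ip H y e \<odot>\<^bsub>H\<^esub> e)"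
    using assms orthonormal_basis_carrier[OF assms(1)] ip_closed
    by (intro M.finsum_cong') auto
  then show ?thesis using assms(1-3) by (simp add: orthonormal_basis_def)
qed

end

section \<open>Adjoints in finite dimension\<close>

text \<open>Since \<open>adj\<close> is a definite description, existence and uniqueness must both
  be shown. Existence comes from an explicit representer, uniqueness from
  \<open>ip_right_cong\<close>.\<close>

lemma ip_adj:
  assumes H: "hilbert_space K H" "vectorspace.fin_dim K H" and G: "hilbert_space K G"
    and T: "T \<in> bounded_ops K H G" and y: "y \<in> carrier G"
  shows "adj H G T y \<in> carrier H"
    and "\<And>x. x \<in> carrier H \<Longrightarrow> ip G (T x) y = ip H x (adj H G T y)"
proof -
  interpret H: hilbert_space K H by fact
  interpret G: hilbert_space K G by fact
  interpret T: mod_hom K H G T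
    using T by unfold_locales (simp add: bounded_ops_def)
  obtain E where E: "H.orthonormal_basis E" using H.orthonormal_basis_exists[OF H(2)] by blast
  have fin: "finite E" and c: "\<And>e. e \<in> E \<Longrightarrow> e \<in> carrier H"
    using E H.orthonormal_basis_carrier[OF E] by (auto simp: H.orthonormal_basis_def)
  have Tc: "T x \<in> carrier G" if "x \<in> carrier H" for x
    using T that by (auto simp: bounded_ops_def module_hom_def)
  \<comment> \<open>A representer \<open>z\<close> must satisfy
    \<open>ip H z e = cnj (ip H e z) = cnj (ip G (T e) y)\<close>, which dictates its
    coordinates.\<close>
  define a where "a e = cnj (ip G (T e) y)" for e
  have a: "a e \<in> carrier K" if "e \<in> E" for e
    unfolding a_def using that c Tc y G.ip_closed by blast
  define z where "z = (\<Oplus>\<^bsub>H\<^esub>e\<in>E. a e \<odot>\<^bsub>H\<^esub> e)"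
  have z: "z \<in> carrier H" unfolding z_def using a c by (intro H.M.finsum_closed) auto
  have ze: "ip H z e = a e" if "e \<in> E" for e
    unfolding z_def using E a that
    by (intro H.ip_lincomb_orthonormal) (auto simp: H.orthonormal_basis_def)
  have Tz: "ip G (T x) y = ip H x z" if x: "x \<in> carrier H" for x
  proof -
    have xe: "ip H x e \<in> carrier K" if "e \<in> E" for e using x that c H.ip_closed by auto
    have "T x = T (H.lincomb (ip H x) E)"
      using E x by (simp add: H.lincomb_def H.orthonormal_basis_def)
    also have "\<dots> = (\<Oplus>\<^bsub>G\<^esub>e\<in>E. ip H x e \<odot>\<^bsub>G\<^esub> T e)"
      unfolding H.lincomb_def
      using fin c xe by (subst T.hom_sum) (auto intro!: G.M.finsum_cong' simp: Tc)
    finally have "ip G (T x) y = (\<Sum>e\<in>E. ip G (ip H x e \<odot>\<^bsub>G\<^esub> T e) y)"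
      using fin y xe c Tc by (simp add: G.ip_finsum_left Pi_iff)
    also have "\<dots> = (\<Sum>e\<in>E. ip H x e * cnj (a e))"
      using y xe c Tc by (intro sum.cong) (auto simp: a_def G.ip_smult_left)
    also have "\<dots> = ip H x z" using E x z ze by (simp add: H.ip_eq_sum_orthonormal_basis)
    finally show ?thesis .
  qed
  have "\<exists>!z. z \<in> carrier H \<and> (\<forall>x\<in>carrier H. ip G (T x) y = ip H x z)"
    using z Tz by (intro ex1I[of _ z]) (auto intro!: H.ip_right_cong)
  from theI'[OF this] show "adj H G T y \<in> carrier H"
    and "\<And>x. x \<in> carrier H \<Longrightarrow> ip G (T x) y = ip H x (adj H G T y)"
    unfolding adj_def by blast+
qed

section \<open>The bound on the number of orthonormal rows\<close>

text \<open>
  \<open>P\<close> is the matrix of the orthogonal projection onto the span of the rows: its trace is \<open>card I\<close>,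
  and \<open>1 - P c c\<close> is the squared norm of the \<open>c\<close>-th row of \<open>1 - P\<close>.
\<close>

lemma card_le_of_orthonormal_rows:
  fixes r :: "'i \<Rightarrow> 'c \<Rightarrow> complex"
  assumes I: "finite I" and C: "finite C"
    and orth: "\<And>i i'. i \<in> I \<Longrightarrow> i' \<in> I \<Longrightarrow>
      (\<Sum>c\<in>C. r i c * cnj (r i' c)) = (if i = i' then 1 else 0)"
  shows "card I \<le> card C"
proof -
  define P where "P c d = (\<Sum>i\<in>I. cnj (r i c) * r i d)" for c d
  define \<delta> where "\<delta> c d = (if c = d then 1 else 0 :: complex)" for c d :: 'c
  \<comment> \<open>The diagonal of \<open>P P^* = P\<close>. Summing over \<open>d\<close> first
    lets the orthonormality of the rows collapse the double sum over \<open>I\<close>.\<close>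
  have PP: "(\<Sum>d\<in>C. P c d * cnj (P c d)) = P c c" for c
  proof -
    have "(\<Sum>d\<in>C. P c d * cnj (P c d)) =
        (\<Sum>d\<in>C. \<Sum>i\<in>I. \<Sum>i'\<in>I. cnj (r i c) * r i' c * (r i d * cnj (r i' d)))"
      by (simp add: P_def sum_product mult_ac)
    also have "\<dots> = (\<Sum>i\<in>I. \<Sum>i'\<in>I. \<Sum>d\<in>C. cnj (r i c) * r i' c * (r i d * cnj (r i' d)))"
      by (subst sum.swap) (intro sum.cong refl sum.swap)
    also have "\<dots> = (\<Sum>i\<in>I. \<Sum>i'\<in>I. if i' = i then cnj (r i c) * r i c else 0)"
      by (intro sum.cong refl) (auto simp: sum_distrib_left[symmetric] orth)
    also have "\<dots> = P c c" using I by (simp add: P_def)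
    finally show ?thesis .
  qed
  have real: "cnj (P c c) = P c c" for c by (simp add: P_def mult.commute)
  have nonneg: "0 \<le> Re (1 - P c c)" if c: "c \<in> C" for c
  proof -
    \<comment> \<open>The cross terms survive only at \<open>d = c\<close>; adding \<open>PP\<close>
      and using that \<open>P c c\<close> is real leaves \<open>1 - P c c\<close>.\<close>
    have "(\<Sum>d\<in>C. (\<delta> c d - P c d) * cnj (\<delta> c d - P c d)) =
        (\<Sum>d\<in>C. (if c = d then 1 - P c c - cnj (P c c) else 0) + P c d * cnj (P c d))"
      by (intro sum.cong) (auto simp: \<delta>_def algebra_simps)
    also have "\<dots> = 1 - P c c" using c C by (simp add: sum.distrib PP real)
    finally have "1 - P c c = (\<Sum>d\<in>C. (\<delta> c d - P c d) * cnj (\<delta> c d - P c d))" ..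
    then show ?thesis by (simp add: complex_mult_cnj sum_nonneg del: complex_cnj_diff)
  qed
  have "(\<Sum>c\<in>C. P c c) = (\<Sum>i\<in>I. \<Sum>c\<in>C. r i c * cnj (r i c))"
    unfolding P_def by (subst sum.swap) (simp add: mult.commute)
  also have "\<dots> = of_nat (card I)" using orth by simp
  finally have "(\<Sum>c\<in>C. 1 - P c c) = of_nat (card C) - of_nat (card I)"
    by (simp add: sum_subtractf)
  moreover have "0 \<le> Re (\<Sum>c\<in>C. 1 - P c c)"
    unfolding Re_sum by (intro sum_nonneg nonneg)
  ultimately show ?thesis by simp
qed

section \<open>From mixed operators to sums of inner products\<close>

text \<open>Each adjoint moves across the inner product by its defining equation and conjugate
  symmetry, so the uniqueness argument can work with sesquilinear sums alone.\<close>

lemma ip_mixed_op: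
  assumes H: "hilbert_space K H" "vectorspace.fin_dim K H"
    and G: "\<And>j. j \<in> {1..m} \<Longrightarrow> hilbert_space K (G j)"
    and V: "\<And>j. j \<in> {1..m} \<Longrightarrow> V j \<in> bounded_ops K H (G j)"
    and W: "\<And>j. j \<in> {1..m} \<Longrightarrow> W j \<in> bounded_ops K H (G j)"
    and x: "x \<in> carrier H" and y: "y \<in> carrier H"
  shows "ip H (mixed_op m H G W V x) y = (\<Sum>j = 1..m. ip (G j) (V j x) (W j y))"
proof -
  interpret H: hilbert_space K H by fact
  have Vx: "V j x \<in> carrier (G j)" and Wy: "W j y \<in> carrier (G j)" if "j \<in> {1..m}" for j
    using V[OF that] W[OF that] x y by (auto simp: bounded_ops_def module_hom_def)
  have adj: "adj H (G j) (W j) (V j x) \<in> carrier H" if "j \<in> {1..m}" for j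
    using ip_adj(1)[OF H G W Vx] that by blast
  have "ip H (mixed_op m H G W V x) y = (\<Sum>j = 1..m. ip H (adj H (G j) (W j) (V j x)) y)"
    unfolding mixed_op_def using adj y by (intro H.ip_finsum_left) auto
  also have "\<dots> = (\<Sum>j = 1..m. ip (G j) (V j x) (W j y))"
  proof (intro sum.cong refl)
    fix j assume j: "j \<in> {1..m}"
    interpret G: hilbert_space K "G j" using G[OF j] .
    show "ip H (adj H (G j) (W j) (V j x)) y = ip (G j) (V j x) (W j y)"
      using ip_adj(2)[OF H G[OF j] W[OF j] Vx[OF j] y] adj[OF j] Vx[OF j] Wy[OF j] y
        H.ip_commute G.ip_commute by metis
  qed
  finally show ?thesis .
qed

section \<open>Uniqueness of the tight dual\<close>

lemma tight_dual_eq_parseval: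
  fixes H :: "'a ip_module"
  assumes H: "hilbert_space K H" "vectorspace.fin_dim K H" "vectorspace.dim K H = n"
    and G: "\<And>j. j \<in> {1..m} \<Longrightarrow> hilbert_space K (G j)"
      "\<And>j. j \<in> {1..m} \<Longrightarrow> vectorspace.fin_dim K (G j)"
      "\<And>j. j \<in> {1..m} \<Longrightarrow> vectorspace.dim K (G j) = l j"
    and l: "(\<Sum>j = 1..m. l j) < 2 * n"
    and V: "parseval_opv_frame K m H G V"
    and W: "dual_opv_frame K m H G V W" "tight_opv_frame K m H G W"
    and j: "j \<in> {1..m}" and x: "x \<in> carrier H"
  shows "W j x = V j x"
proof -
  interpret H: hilbert_space K H by fact
  have Vb: "V j \<in> bounded_ops K H (G j)" and Wb: "W j \<in> bounded_ops K H (G j)"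
    if "j \<in> {1..m}" for j
    using V W that unfolding parseval_opv_frame_def tight_opv_frame_with_bound_def
      dual_opv_frame_def opv_frame_def by blast+
  have Vc: "V j x \<in> carrier (G j)" and Wc: "W j x \<in> carrier (G j)"
    if "j \<in> {1..m}" "x \<in> carrier H" for j x
    using Vb[OF that(1)] Wb[OF that(1)] that(2) by (auto simp: bounded_ops_def module_hom_def)
  obtain A where A: "\<And>x. x \<in> carrier H \<Longrightarrow> mixed_op m H G W W x = scalar_op H A x"
    using W(2) unfolding tight_opv_frame_def tight_opv_frame_with_bound_def by blast
  have scalar_ip: "ip H (scalar_op H a x) y = of_real a * ip H x y"
    if "x \<in> carrier H" "y \<in> carrier H" for a x y
    using that by (simp add: scalar_op_def H.ip_smult_left)
  have VV: "(\<Sum>j = 1..m. ip (G j) (V j x) (V j y)) = ip H x y"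
    and VW: "(\<Sum>j = 1..m. ip (G j) (V j x) (W j y)) = ip H x y"
    and WW: "(\<Sum>j = 1..m. ip (G j) (W j x) (W j y)) = of_real A * ip H x y"
    if "x \<in> carrier H" "y \<in> carrier H" for x y
  proof -
    note mixed = ip_mixed_op[OF H(1,2) G(1) _ _ that, symmetric]
    show "(\<Sum>j = 1..m. ip (G j) (V j x) (V j y)) = ip H x y"
      using V that scalar_ip[OF that] unfolding parseval_opv_frame_def tight_opv_frame_with_bound_def
      by (subst mixed) (auto intro: Vb)
    show "(\<Sum>j = 1..m. ip (G j) (V j x) (W j y)) = ip H x y"
      using W(1) that unfolding dual_opv_frame_def by (subst mixed) (auto intro: Vb Wb)
    show "(\<Sum>j = 1..m. ip (G j) (W j x) (W j y)) = of_real A * ip H x y"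
      using A that scalar_ip[OF that] by (subst mixed) (auto intro: Wb)
  qed
  \<comment> \<open>Duality fixes one order of the factors; the other follows by
    conjugation.\<close>
  have WV: "(\<Sum>j = 1..m. ip (G j) (W j x) (V j y)) = ip H x y"
    if "x \<in> carrier H" "y \<in> carrier H" for x y
  proof -
    have "(\<Sum>j = 1..m. ip (G j) (W j x) (V j y)) = cnj (\<Sum>j = 1..m. ip (G j) (V j y) (W j x))"
      unfolding cnj_sum using that
      by (intro sum.cong refl hilbert_space.ip_commute[OF G(1)] Vc Wc)
    then show ?thesis unfolding VW[OF that(2,1)] H.ip_commute[OF that] .
  qed
  obtain E where E: "H.orthonormal_basis E" and cardE: "card E = n"
    using H.orthonormal_basis_exists H by metis
  have finE: "finite E" and Ec: "\<And>e. e \<in> E \<Longrightarrow> e \<in> carrier H"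
    and Eo: "\<And>e e'. e \<in> E \<Longrightarrow> e' \<in> E \<Longrightarrow> ip H e e' = (if e = e' then 1 else 0)"
    using E H.orthonormal_basis_carrier[OF E]
    by (auto simp: H.orthonormal_basis_def H.orthonormal_def)
  have "\<forall>j\<in>{1..m}. \<exists>F. hilbert_space.orthonormal_basis (G j) F \<and> card F = l j"
    using hilbert_space.orthonormal_basis_exists[OF G(1) G(2)] G(3) by metis
  then obtain F where F: "\<And>j. j \<in> {1..m} \<Longrightarrow> hilbert_space.orthonormal_basis (G j) (F j)"
    and cardF: "\<And>j. j \<in> {1..m} \<Longrightarrow> card (F j) = l j"
    by metis
  have finF: "finite (F j)" if "j \<in> {1..m}" for j
    using F[OF that] hilbert_space.orthonormal_basis_def[OF G(1)[OF that]] by blast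
  \<comment> \<open>The index set of coordinates on the direct sum. Tagging basis vectors with
    \<open>j\<close> keeps the summands apart even where the sets \<open>F j\<close>
    overlap.\<close>
  define C where "C = Sigma {1..m} F"
  have finC: "finite C" using finF by (auto simp: C_def)
  have cardC: "card C = (\<Sum>j = 1..m. l j)"
    unfolding C_def using finF cardF by simp
  \<comment> \<open>Coordinates of the images of \<open>x\<close> under the two frames. They are
    complex numbers for either scalar field, so one counting lemma covers both.\<close>
  define v where "v x c = ip (G (fst c)) (V (fst c) x) (snd c)" for x c
  define w where "w x c = ip (G (fst c)) (W (fst c) x) (snd c)" for x c
  \<comment> \<open>Parseval's identity summed over the spaces, for arbitrary \<open>S\<close> and
    \<open>T\<close> so that it yields all four Gram sums.\<close>
  have coord: "(\<Sum>c\<in>C. ip (G (fst c)) (S (fst c) x) (snd c) * cnj (ip (G (fst c)) (T (fst c) y) (snd c)))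
      = (\<Sum>j = 1..m. ip (G j) (S j x) (T j y))"
    if "\<And>j. j \<in> {1..m} \<Longrightarrow> S j x \<in> carrier (G j)" "\<And>j. j \<in> {1..m} \<Longrightarrow> T j y \<in> carrier (G j)"
    for S T :: "nat \<Rightarrow> _" and x y
  proof -
    have "(\<Sum>c\<in>C. ip (G (fst c)) (S (fst c) x) (snd c) * cnj (ip (G (fst c)) (T (fst c) y) (snd c)))
      = (\<Sum>j = 1..m. \<Sum>f\<in>F j. ip (G j) (S j x) f * cnj (ip (G j) (T j y) f))"
      unfolding C_def using finF by (subst sum.Sigma) (auto simp: case_prod_beta)
    also have "\<dots> = (\<Sum>j = 1..m. ip (G j) (S j x) (T j y))"
      using that
      by (intro sum.cong refl hilbert_space.ip_eq_sum_orthonormal_basis[OF G(1) F, symmetric])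
    finally show ?thesis .
  qed
  have vv: "(\<Sum>c\<in>C. v x c * cnj (v y c)) = ip H x y"
    and vw: "(\<Sum>c\<in>C. v x c * cnj (w y c)) = ip H x y"
    and wv: "(\<Sum>c\<in>C. w x c * cnj (v y c)) = ip H x y"
    and ww: "(\<Sum>c\<in>C. w x c * cnj (w y c)) = of_real A * ip H x y"
    if "x \<in> carrier H" "y \<in> carrier H" for x y
    unfolding v_def w_def
    using coord[of V x V y] coord[of V x W y] coord[of W x V y] coord[of W x W y]
      Vc[OF _ that(1)] Vc[OF _ that(2)] Wc[OF _ that(1)] Wc[OF _ that(2)]
      VV[OF that] VW[OF that] WV[OF that] WW[OF that] by metis+
  \<comment> \<open>Coordinates of \<open>W - V\<close>, subtracted as complex numbers, so that no
    difference operator has to be formed. Its Gram sums follow by expansion: \<open>uu\<close> has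
    the factor \<open>A - 1 - 1 + 1\<close>.\<close>
  define u where "u x c = w x c - v x c" for x c
  have vu: "(\<Sum>c\<in>C. v x c * cnj (u y c)) = 0"
    and uv: "(\<Sum>c\<in>C. u x c * cnj (v y c)) = 0"
    and uu: "(\<Sum>c\<in>C. u x c * cnj (u y c)) = of_real (A - 1) * ip H x y"
    if "x \<in> carrier H" "y \<in> carrier H" for x y
    unfolding u_def using vv[OF that] vw[OF that] wv[OF that] ww[OF that]
    by (simp_all add: algebra_simps sum.distrib sum_subtractf)
  have uu_norm: "(\<Sum>c\<in>C. u x c * cnj (u x c)) = of_real (\<Sum>c\<in>C. (cmod (u x c))\<^sup>2)" for x
    by (simp add: complex_norm_square flip: of_real_power)
  have "A = 1"
  proof (rule ccontr)
    assume "A \<noteq> 1"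
    \<comment> \<open>The strict bound by \<open>2 * n\<close> forces \<open>n > 0\<close>, so a
      unit vector is available. For it, \<open>A - 1\<close> is a squared norm and hence
      nonnegative.\<close>
    obtain e where e: "e \<in> E" using cardE l by fastforce
    have "complex_of_real (A - 1) = of_real (\<Sum>c\<in>C. (cmod (u e c))\<^sup>2)"
      using uu[of e e] uu_norm[of e] e Ec Eo by simp
    then have "A - 1 = (\<Sum>c\<in>C. (cmod (u e c))\<^sup>2)" by (simp only: of_real_eq_iff)
    moreover have "\<dots> \<ge> 0" by (intro sum_nonneg) simp
    ultimately have "A > 1" using \<open>A \<noteq> 1\<close> by simp
    define s where "s = complex_of_real (sqrt (A - 1))"
    have s: "s \<noteq> 0" "cnj s = s" "s * s = of_real (A - 1)"
      using \<open>A > 1\<close> by (auto simp: s_def simp flip: of_real_mult)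
    \<comment> \<open>The Boolean tag separates the rows of \<open>V\<close> from the rescaled rows
      of \<open>U\<close>, so there are \<open>2 * n\<close> indices without a prior check that the
      rows differ.\<close>
    define r where "r i c = (if fst i then v (snd i) c else u (snd i) c / s)" for i :: "bool \<times> 'a" and c
    have "card ((UNIV :: bool set) \<times> E) \<le> card C"
    proof (rule card_le_of_orthonormal_rows[where r = r])
      fix i i' :: "bool \<times> 'a" assume "i \<in> UNIV \<times> E" "i' \<in> UNIV \<times> E"
      then obtain a e b e' where i: "i = (a, e)" "i' = (b, e')" and e: "e \<in> E" "e' \<in> E"
        by auto
      have ec: "e \<in> carrier H" "e' \<in> carrier H" using e Ec by auto
      \<comment> \<open>Different tags give zero by \<open>vu\<close> and \<open>uv\<close>. Equal
        tags reduce to the orthonormality of \<open>E\<close>, where for the \<open>u\<close> rows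
        \<open>s * s\<close> cancels \<open>A - 1\<close>.\<close>
      show "(\<Sum>c\<in>C. r i c * cnj (r i' c)) = (if i = i' then 1 else 0)"
        using vv[OF ec] vu[OF ec] uv[OF ec] uu[OF ec] s Eo[OF e] \<open>A \<noteq> 1\<close>
        by (cases a; cases b) (simp_all add: i r_def flip: sum_divide_distrib)
    qed (use finE finC in auto)
    then show False using cardE cardC l by (simp add: card_cartesian_product)
  qed
  \<comment> \<open>With \<open>A = 1\<close> the vector \<open>u x\<close> has norm zero; its
    coordinates at the pairs \<open>(j, f)\<close> then identify \<open>W j x\<close> with
    \<open>V j x\<close>.\<close>
  then have "of_real (\<Sum>c\<in>C. (cmod (u x c))\<^sup>2) = complex_of_real 0"
    using uu[OF x x] uu_norm[of x] by simp
  then have "(\<Sum>c\<in>C. (cmod (u x c))\<^sup>2) = 0" by (simp only: of_real_eq_iff)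
  then have "u x c = 0" if "c \<in> C" for c
    using that finC by (simp add: sum_nonneg_eq_0_iff)
  then have "ip (G j) (W j x) f = ip (G j) (V j x) f" if "f \<in> F j" for f
    using that j by (force simp: u_def v_def w_def C_def)
  then show ?thesis
    using hilbert_space.orthonormal_basis_eqI[OF G(1)[OF j] F[OF j]] Vc Wc j x by blast
qed

section \<open>The Parseval frame as its own tight dual\<close>

text \<open>Operators are total functions, but agreement is known only on the carrier. The
  description in \<open>adj\<close> tests an operator only there, so the adjoints coincide as
  functions.\<close>

lemma mixed_op_cong:
  assumes H: "hilbert_space K H" "vectorspace.fin_dim K H"
    and G: "\<And>j. j \<in> {1..m} \<Longrightarrow> hilbert_space K (G j)"
    and V: "\<And>j. j \<in> {1..m} \<Longrightarrow> V j \<in> bounded_ops K H (G j)"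
    and eq: "\<And>j x. j \<in> {1..m} \<Longrightarrow> x \<in> carrier H \<Longrightarrow> S j x = V j x"
      "\<And>j x. j \<in> {1..m} \<Longrightarrow> x \<in> carrier H \<Longrightarrow> T j x = V j x"
    and x: "x \<in> carrier H"
  shows "mixed_op m H G S T x = mixed_op m H G V V x"
proof -
  interpret H: hilbert_space K H by fact
  have adj: "adj H (G j) (S j) = adj H (G j) (V j)" if "j \<in> {1..m}" for j
    using eq(1)[OF that] by (auto simp: adj_def fun_eq_iff intro!: arg_cong[where f = The])
  have "adj H (G j) (V j) (V j x) \<in> carrier H" if "j \<in> {1..m}" for j
    using ip_adj(1)[OF H G[OF that] V[OF that]] V[OF that] x
    by (auto simp: bounded_ops_def module_hom_def)
  then show ?thesis
    unfolding mixed_op_def using adj eq(2) x by (intro H.M.finsum_cong') auto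
qed

text \<open>Boundedness and the frame inequalities refer only to vectors of the carrier, so
  \<open>W\<close> inherits them; the Parseval identity of \<open>V\<close> then supplies both
  duality and tightness with bound 1.\<close>

lemma parseval_dual_of_eq:
  assumes H: "hilbert_space K H" "vectorspace.fin_dim K H"
    and G: "\<And>j. j \<in> {1..m} \<Longrightarrow> hilbert_space K (G j)"
    and V: "parseval_opv_frame K m H G V"
    and eq: "\<And>j x. j \<in> {1..m} \<Longrightarrow> x \<in> carrier H \<Longrightarrow> W j x = V j x"
  shows "dual_opv_frame K m H G V W \<and> tight_opv_frame K m H G W"
proof -
  interpret H: hilbert_space K H by fact
  have Vb: "V j \<in> bounded_ops K H (G j)" if "j \<in> {1..m}" for j
    using V that unfolding parseval_opv_frame_def tight_opv_frame_with_bound_def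
      opv_frame_def by blast
  have Wb: "W j \<in> bounded_ops K H (G j)" if "j \<in> {1..m}" for j
    using Vb[OF that] eq[OF that] by (auto simp: bounded_ops_def module_hom_def)
  have one: "scalar_op H 1 x = x" if "x \<in> carrier H" for x
    using that H.smult_one[of x] by (simp add: scalar_op_def)
  have VV: "mixed_op m H G V V x = scalar_op H 1 x" if "x \<in> carrier H" for x
    using V that unfolding parseval_opv_frame_def tight_opv_frame_with_bound_def by blast
  have WV: "mixed_op m H G W V x = x" and WW: "mixed_op m H G W W x = scalar_op H 1 x"
    if "x \<in> carrier H" for x
    using that mixed_op_cong[OF H G Vb, where S = W and T = V and x = x]
      mixed_op_cong[OF H G Vb, where S = W and T = W and x = x] eq VV one
    by auto
  have "op_le H (scalar_op H a) (mixed_op m H G W W) \<longleftrightarrow>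
        op_le H (scalar_op H a) (mixed_op m H G V V)"
    "op_le H (mixed_op m H G W W) (scalar_op H a) \<longleftrightarrow>
        op_le H (mixed_op m H G V V) (scalar_op H a)" for a
    by (simp_all add: op_le_def positive_op_def VV WW)
  then have "opv_frame K m H G W"
    using V Wb unfolding parseval_opv_frame_def tight_opv_frame_with_bound_def opv_frame_def
    by simp
  moreover have "tight_opv_frame_with_bound K m H G W 1"
    using calculation WW by (simp add: tight_opv_frame_with_bound_def)
  ultimately show ?thesis
    using WV unfolding dual_opv_frame_def tight_opv_frame_def by blast
qed

theorem theorem12:
  fixes K :: "complex ring" and H :: "'b ip_module" and G :: "nat \<Rightarrow> 'c ip_module"
    and V :: "nat \<Rightarrow> 'b \<Rightarrow> 'c" and m n :: nat and l :: "nat \<Rightarrow> nat"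
  assumes "hilbert_space K H"
    and "vectorspace.fin_dim K H" and "vectorspace.dim K H = n"
    and "\<And>j. j \<in> {1..m} \<Longrightarrow> hilbert_space K (G j)"
    and "\<And>j. j \<in> {1..m} \<Longrightarrow> vectorspace.fin_dim K (G j)"
    and "\<And>j. j \<in> {1..m} \<Longrightarrow> vectorspace.dim K (G j) = l j"
    and "parseval_opv_frame K m H G V"
    and "(\<Sum>j = 1..m. l j) < 2 * n"
  shows "\<forall>W. (dual_opv_frame K m H G V W \<and> tight_opv_frame K m H G W) \<longleftrightarrow>
             (\<forall>j\<in>{1..m}. \<forall>x\<in>carrier H. W j x = V j x)"
proof (intro allI iffI ballI)
  fix W j x
  assume "dual_opv_frame K m H G V W \<and> tight_opv_frame K m H G W"
    and "j \<in> {1..m}" and "x \<in> carrier H"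
  then show "W j x = V j x"
    using tight_dual_eq_parseval[OF assms(1-6,8,7)] by blast
next
  fix W
  assume "\<forall>j\<in>{1..m}. \<forall>x\<in>carrier H. W j x = V j x"
  then show "dual_opv_frame K m H G V W \<and> tight_opv_frame K m H G W"
    by (intro parseval_dual_of_eq[OF assms(1,2,4,7)]) auto
qed

end
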